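(* Let $n\ge1$ and let $\underline{a}$ and $\underline{b}$ be distinct arc-connected words of the list $G_n$ such that every word listed strictly between them in $G_n$ is arc-disconnected. Then $\pi(\underline{a})$ and $\pi(\underline{b})$ differ by an adjacent transposition. Consequently, deleting from the list $(\pi(\underline{a}))_{\underline{a}\in G_n}$ all sign-disconnected permutations yields an adjacent transposition Gray code for the sign-connected standard permutations of $\{\pm1,\ldots,\pm n\}$ (which encode the shelling types of the boundary of the $n$-cube).
   Context: A standard permutation of $\{\pm1,\ldots,\pm n\}$ is a word in which each element appears exactly once, $i$ occurs before $-i$ for each $i$, and the negative entries occur in the order $-1,\ldots,-n$. For a word $a_1\cdots a_n$ with $1\le a_i\le 2i-1$, $\pi(a_1\cdots a_n)$ is defined recursively: $\pi(a_1)=(1,-1)$, and for $n\ge2$, $\pi(a_1\cdots a_n)$ is obtained from $\pi(a_1\cdots a_{n-1})$ (length $2n-2$) by inserting $n$ so that it occupies position $a_n$ and then appending $-n$ at the end. The list $G_n$ of such words is defined recursively: $G_1=(1)$; for $n\ge2$, if $G_{n-1}=(w_1,\ldots,w_N)$, then $G_n$ is the concatenation over $m=1,\ldots,N$ of the blocks $(w_m1,\ldots,w_m(2n-1))$ for $m$ odd and $(w_m(2n-1),\ldots,w_m1)$ for $m$ even, where $w_mx$ denotes $w_m$ with the letter $x$ appended. A permutation $\pi$ of $\{\pm1,\ldots,\pm n\}$ is sign-connected if for every $1\le m<2n$ there is $j$ with $|\{\pi(1),\ldots,\pi(m)\}\cap\{-j,j\}|=1$, otherwise sign-disconnected. A word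 $\underline{a}$ is arc-connected if $\pi(\underline{a})$ is sign-connected, arc-disconnected otherwise. Two words of length $2n$ differ by an adjacent transposition if one is obtained from the other by exchanging the entries in two consecutive positions. *)

theory Defs
  imports Main
begin

definition standard_perm :: "nat \<Rightarrow> int list \<Rightarrow> bool" where
  "standard_perm n p \<longleftrightarrow>
     distinct p \<and> set p = {1..int n} \<union> uminus ` {1..int n} \<and>
     (\<forall>i\<in>{1..int n}. \<exists>k l. k < l \<and> l < length p \<and> p ! k = i \<and> p ! l = - i) \<and>
     filter (\<lambda>x. x < 0) p = map (\<lambda>i. - int i) [1..<Suc n]"

text \<open>Inserts \<open>n\<close> so that it occupies position \<open>a\<close> (counted from 1), then appends \<open>-n\<close>.\<close>

definition insert_arc :: "nat \<Rightarrow> nat \<Rightarrow> int list \<Rightarrow> int list" where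
  "insert_arc n a p = take (a - 1) p @ [int n] @ drop (a - 1) p @ [- int n]"

text \<open>The recursion removes the last letter of the word, so it is carried out on the
  reversed word. The value on the empty word is an irrelevant default.\<close>

fun word_perm_rev :: "nat list \<Rightarrow> int list" where
  "word_perm_rev [] = []"
| "word_perm_rev [a] = [1, -1]"
| "word_perm_rev (a # b # w) = insert_arc (length (a # b # w)) a (word_perm_rev (b # w))"

definition word_perm :: "nat list \<Rightarrow> int list" where
  "word_perm a = word_perm_rev (rev a)"

text \<open>\<open>gray_block n m w\<close> is the block of words of length \<open>n\<close> extending the \<open>m\<close>-th word
  \<open>w\<close> of the previous list (\<open>m\<close> counted from 1); the value \<open>gray_words 0\<close> is an irrelevant
  default.\<close>

definition gray_block :: "nat \<Rightarrow> nat \<Rightarrow> nat list \<Rightarrow> nat list list" where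
  "gray_block n m w =
     map (\<lambda>x. w @ [x]) (if odd m then [1..<2 * n] else rev [1..<2 * n])"

fun gray_words :: "nat \<Rightarrow> nat list list" where
  "gray_words 0 = []"
| "gray_words (Suc 0) = [[1]]"
| "gray_words (Suc (Suc n)) =
     (let W = gray_words (Suc n)
      in concat (map (\<lambda>m. gray_block (Suc (Suc n)) m (W ! (m - 1))) [1..<Suc (length W)]))"

definition sign_connected :: "nat \<Rightarrow> int list \<Rightarrow> bool" where
  "sign_connected n p \<longleftrightarrow>
     (\<forall>m. 1 \<le> m \<and> m < 2 * n \<longrightarrow> (\<exists>j\<in>{1..int n}. card (set (take m p) \<inter> {- j, j}) = 1))"

definition arc_connected :: "nat list \<Rightarrow> bool" where
  "arc_connected a \<longleftrightarrow> sign_connected (length a) (word_perm a)"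

definition adjacent_transposition :: "'a list \<Rightarrow> 'a list \<Rightarrow> bool" where
  "adjacent_transposition u v \<longleftrightarrow>
     (\<exists>i. Suc i < length u \<and> v = u[i := u ! Suc i, Suc i := u ! i])"

definition adjacent_transposition_gray_code :: "'a list set \<Rightarrow> 'a list list \<Rightarrow> bool" where
  "adjacent_transposition_gray_code S L \<longleftrightarrow>
     distinct L \<and> set L = S \<and>
     (\<forall>i. Suc i < length L \<longrightarrow> adjacent_transposition (L ! i) (L ! Suc i))"

end

theory Submission
  imports Defs
begin

text \<open>Let \<open>c(w)\<close> be the least positive length of a prefix of the permutation of \<open>w\<close> that is
  closed under negation. Inserting \<open>n\<close> at position \<open>x\<close> gives a sign-connected permutation iff
  \<open>x \<le> c(w)\<close>, so in each block of the list the connected words are exactly those ending in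
  \<open>1, \<dots>, c(w)\<close>. Neighbouring blocks meeting at their ends \<open>1\<close> cause no problem; two blocks
  meeting at the ends \<open>2n - 1\<close> leave a jump from \<open>w c(w)\<close> to \<open>w' c(w')\<close>. This happens only when
  \<open>w\<close> has odd index in its list, and there \<open>c(w) = c(w')\<close>: this is preserved by the
  recursion because \<open>c\<close> is even and the blocks have odd length.\<close>

section \<open>Adjacent transpositions\<close>

lemma adjacent_transposition_iff:
  "adjacent_transposition p q \<longleftrightarrow> (\<exists>u x y v. p = u @ x # y # v \<and> q = u @ y # x # v)"
proof
  assume "adjacent_transposition p q"
  then obtain i where i: "Suc i < length p" "q = p[i := p ! Suc i, Suc i := p ! i]"
    by (auto simp: adjacent_transposition_def)
  have p: "p = take i p @ p ! i # p ! Suc i # drop (Suc (Suc i)) p"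
    using i(1) by (metis Cons_nth_drop_Suc Suc_lessD append_take_drop_id)
  have "length (take i p) = i" using i(1) by simp
  then have "q = take i p @ p ! Suc i # p ! i # drop (Suc (Suc i)) p"
    using i(2) p by (metis list_update_append1 list_update_length append_Cons append_Nil
        append_assoc length_append_singleton)
  with p show "\<exists>u x y v. p = u @ x # y # v \<and> q = u @ y # x # v" by blast
next
  assume "\<exists>u x y v. p = u @ x # y # v \<and> q = u @ y # x # v"
  then obtain u x y v where "p = u @ x # y # v" "q = u @ y # x # v" by blast
  then show "adjacent_transposition p q"
    unfolding adjacent_transposition_def
    by (intro exI[of _ "length u"]) (simp add: nth_append list_update_append)
qed

lemma adjacent_transposition_sym:
  "adjacent_transposition p q \<Longrightarrow> adjacent_transposition q p"
  unfolding adjacent_transposition_iff by blast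

lemma adjacent_transposition_append:
  "adjacent_transposition p q \<Longrightarrow> adjacent_transposition (s @ p @ t) (s @ q @ t)"
  unfolding adjacent_transposition_iff by (metis append_Cons append_assoc)

text \<open>Moving the new entry one place to the right exchanges it with
  \<open>p ! (a - 1)\<close>; the bound \<open>a \<le> length p\<close> keeps this exchange clear of
  the appended negative entry.\<close>

lemma adjacent_transposition_insert_arc_Suc:
  assumes "1 \<le> a" "a \<le> length p"
  shows "adjacent_transposition (insert_arc n a p) (insert_arc n (Suc a) p)"
proof -
  have "drop (a - 1) p = p ! (a - 1) # drop a p" "take a p = take (a - 1) p @ [p ! (a - 1)]"
    using assms Cons_nth_drop_Suc[of "a - 1" p] take_Suc_conv_app_nth[of "a - 1" p] by auto
  then show ?thesis
    unfolding adjacent_transposition_iff insert_arc_def by auto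
qed

section \<open>Standard permutations\<close>

text \<open>Inserting entries of other absolute values shifts positions but leaves a filter by
  absolute value unchanged, so the filter form suits the recursion.\<close>

lemma pair_order_iff_filter:
  fixes p :: "int list"
  assumes "distinct p" "i > 0"
  shows "(\<exists>k l. k < l \<and> l < length p \<and> p ! k = i \<and> p ! l = - i) \<longleftrightarrow>
         filter (\<lambda>x. \<bar>x\<bar> = i) p = [i, - i]"
proof
  assume "\<exists>k l. k < l \<and> l < length p \<and> p ! k = i \<and> p ! l = - i"
  then obtain k l where kl: "k < l" "l < length p" "p ! k = i" "p ! l = - i" by blast
  define t where "t = drop (Suc k) p"
  have p: "p = take k p @ i # t"
    using kl by (metis id_take_nth_drop order.strict_trans t_def)
  have "t ! (l - Suc k) = - i" "l - Suc k < length t"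
    using kl by (auto simp: t_def)
  then have t: "t = take (l - Suc k) t @ (- i) # drop (Suc (l - Suc k)) t"
    by (metis id_take_nth_drop)
  obtain u v w where p': "p = u @ i # v @ (- i) # w" using p t by metis
  have "\<bar>x\<bar> \<noteq> i" if "x \<in> set u \<union> set v \<union> set w" for x
  proof -
    have "x \<noteq> i" "x \<noteq> - i" using that assms(1) unfolding p' by auto
    then show ?thesis by linarith
  qed
  then have "filter (\<lambda>x. \<bar>x\<bar> = i) u = []" "filter (\<lambda>x. \<bar>x\<bar> = i) v = []"
    "filter (\<lambda>x. \<bar>x\<bar> = i) w = []"
    by (auto simp: filter_empty_conv)
  then show "filter (\<lambda>x. \<bar>x\<bar> = i) p = [i, - i]"
    using assms(2) by (simp add: p')
next
  assume "filter (\<lambda>x. \<bar>x\<bar> = i) p = [i, - i]"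
  then obtain u t where "p = u @ i # t" "[- i] = filter (\<lambda>x. \<bar>x\<bar> = i) t"
    unfolding filter_eq_Cons_iff by blast
  moreover from this(2) obtain v w where "t = v @ (- i) # w"
    unfolding Cons_eq_filter_iff by blast
  ultimately have p: "p = u @ i # v @ (- i) # w" by simp
  show "\<exists>k l. k < l \<and> l < length p \<and> p ! k = i \<and> p ! l = - i"
    by (rule exI[of _ "length u"], rule exI[of _ "Suc (length u + length v)"])
       (simp add: p nth_append)
qed

lemma standard_perm_iff:
  "standard_perm n p \<longleftrightarrow>
     distinct p \<and> set p = {1..int n} \<union> uminus ` {1..int n} \<and>
     (\<forall>i\<in>{1..int n}. filter (\<lambda>x. \<bar>x\<bar> = i) p = [i, - i]) \<and>
     filter (\<lambda>x. x < 0) p = map (\<lambda>i. - int i) [1..<Suc n]"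
  unfolding standard_perm_def using pair_order_iff_filter by fastforce

lemma set_standard_perm_iff:
  "standard_perm n p \<Longrightarrow> x \<in> set p \<longleftrightarrow> 1 \<le> \<bar>x\<bar> \<and> \<bar>x\<bar> \<le> int n"
  unfolding standard_perm_def by (auto simp: image_iff intro!: bexI[of _ "- x"])

lemma length_standard_perm:
  assumes "standard_perm n p"
  shows "length p = 2 * n"
proof -
  have "length p = card ({1..int n} \<union> uminus ` {1..int n})"
    using assms unfolding standard_perm_def by (metis distinct_card)
  also have "\<dots> = card {1..int n} + card (uminus ` {1..int n})"
    by (rule card_Un_disjoint) auto
  also have "\<dots> = 2 * n"
    by (simp add: card_image)
  finally show ?thesis .
qed

text \<open>If \<open>z\<close> were positive, the filter by absolute value would put it before
  \<open>- z\<close>. The lemma serves twice: for the last entry of a permutation and for the entry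
  at a closed cut.\<close>

lemma standard_perm_neg_before:
  assumes "standard_perm n (u @ z # v)" "- z \<in> set u"
  shows "z < 0"
proof (rule ccontr)
  assume "\<not> z < 0"
  then have z: "z \<in> {1..int n}" using set_standard_perm_iff[OF assms(1), of z] by auto
  then have f: "filter (\<lambda>x. \<bar>x\<bar> = z) (u @ z # v) = [z, - z]"
    using assms(1) by (simp add: standard_perm_iff del: filter_append filter.simps)
  have "z \<notin> set u" using assms(1) by (auto simp: standard_perm_def)
  from assms(2) z have "- z \<in> set (filter (\<lambda>x. \<bar>x\<bar> = z) u)" by simp
  moreover have "z \<notin> set (filter (\<lambda>x. \<bar>x\<bar> = z) u)" using \<open>z \<notin> set u\<close> by simp
  ultimately show False
    using f by (cases "filter (\<lambda>x. \<bar>x\<bar> = z) u") auto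
qed

lemma standard_perm_0_iff: "standard_perm 0 p \<longleftrightarrow> p = []"
  by (auto simp: standard_perm_def)

text \<open>The two conditions are treated jointly because the set equation alone does not exclude
  that \<open>x\<close> or \<open>y\<close> occurs again in \<open>u @ v\<close>; distinctness
  does.\<close>

lemma distinct_set_insert2_iff:
  assumes "x \<notin> A" "y \<notin> A" "x \<noteq> y"
  shows "distinct (u @ x # v @ [y]) \<and> set (u @ x # v @ [y]) = insert x (insert y A) \<longleftrightarrow>
    distinct (u @ v) \<and> set (u @ v) = A"
proof -
  have "set (u @ x # v @ [y]) = insert x (insert y (set (u @ v)))" by auto
  moreover have "insert x (insert y S) = insert x (insert y A) \<longleftrightarrow> S = A" if "x \<notin> S" "y \<notin> S" for S
    using assms that by (metis insert_ident insert_iff)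
  moreover have "distinct (u @ x # v @ [y]) \<longleftrightarrow> distinct (u @ v) \<and> x \<notin> set (u @ v) \<and> y \<notin> set (u @ v)"
    using assms(3) by auto
  ultimately show ?thesis using assms(1,2) by metis
qed

text \<open>The equivalence serves both directions of the recursion: adding the arc of
  \<open>Suc n\<close> and removing it again.\<close>

lemma standard_perm_split_iff:
  "standard_perm (Suc n) (u @ int (Suc n) # v @ [- int (Suc n)]) \<longleftrightarrow> standard_perm n (u @ v)"
  (is "standard_perm _ ?q \<longleftrightarrow> _")
proof -
  let ?N = "int (Suc n)"
  have S: "{1..?N} \<union> uminus ` {1..?N} = insert ?N (insert (- ?N) ({1..int n} \<union> uminus ` {1..int n}))"
  proof -
    have "{1..?N} = insert ?N {1..int n}" by auto
    then show ?thesis by (simp only: image_insert) auto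
  qed
  have nin: "?N \<notin> {1..int n} \<union> uminus ` {1..int n}" "- ?N \<notin> {1..int n} \<union> uminus ` {1..int n}"
    by auto
  have set_eq: "distinct ?q \<and> set ?q = {1..?N} \<union> uminus ` {1..?N} \<longleftrightarrow>
      distinct (u @ v) \<and> set (u @ v) = {1..int n} \<union> uminus ` {1..int n}"
    unfolding S by (rule distinct_set_insert2_iff[OF nin]) simp
  show ?thesis
  \<comment> \<open>If this condition holds, all entries of \<open>u\<close> and \<open>v\<close>
    have smaller absolute value than the new pair, and the filter conditions can be compared. If it
    fails, both sides are false by \<open>set_eq\<close>.\<close>
  proof (cases "distinct (u @ v) \<and> set (u @ v) = {1..int n} \<union> uminus ` {1..int n}")
    case True
    then have le: "\<bar>x\<bar> \<noteq> ?N" if "x \<in> set u \<union> set v" for x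
      using that by auto
    then have "filter (\<lambda>x. \<bar>x\<bar> = ?N) u = []" "filter (\<lambda>x. \<bar>x\<bar> = ?N) v = []"
      by (auto simp: filter_empty_conv)
    then have top: "filter (\<lambda>x. \<bar>x\<bar> = ?N) ?q = [?N, - ?N]" by simp
    have low: "filter (\<lambda>x. \<bar>x\<bar> = i) ?q = filter (\<lambda>x. \<bar>x\<bar> = i) (u @ v)" if "i \<in> {1..int n}" for i
      using that by auto
    have "{1..?N} = insert ?N {1..int n}" by auto
    then have "(\<forall>i\<in>{1..?N}. filter (\<lambda>x. \<bar>x\<bar> = i) ?q = [i, - i]) \<longleftrightarrow>
        (\<forall>i\<in>{1..int n}. filter (\<lambda>x. \<bar>x\<bar> = i) ?q = [i, - i])"
      using top by (simp only: ball_simps simp_thms)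
    also have "\<dots> \<longleftrightarrow> (\<forall>i\<in>{1..int n}. filter (\<lambda>x. \<bar>x\<bar> = i) (u @ v) = [i, - i])"
      using low by (intro ball_cong) (simp_all only:)
    finally have pairs: "(\<forall>i\<in>{1..?N}. filter (\<lambda>x. \<bar>x\<bar> = i) ?q = [i, - i]) \<longleftrightarrow>
        (\<forall>i\<in>{1..int n}. filter (\<lambda>x. \<bar>x\<bar> = i) (u @ v) = [i, - i])" .
    have neg: "filter (\<lambda>x. x < 0) ?q = map (\<lambda>i. - int i) [1..<Suc (Suc n)] \<longleftrightarrow>
        filter (\<lambda>x. x < 0) (u @ v) = map (\<lambda>i. - int i) [1..<Suc n]"
      by simp
    show ?thesis
      unfolding standard_perm_iff by (simp only: pairs neg conj_assoc[symmetric] set_eq)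
  next
    case False
    then show ?thesis
      unfolding standard_perm_iff by (simp only: conj_assoc[symmetric] set_eq simp_thms)
  qed
qed

lemma standard_perm_insert_arc:
  "standard_perm n p \<Longrightarrow> standard_perm (Suc n) (insert_arc (Suc n) a p)"
  using standard_perm_split_iff[of n "take (a - 1) p" "drop (a - 1) p"]
  by (simp add: insert_arc_def del: of_nat_Suc)

text \<open>The entry \<open>- int (Suc n)\<close> is the last negative one, and the last entry of a
  standard permutation is negative because its opposite precedes it. So \<open>- int (Suc n)\<close>
  stands at the end, and deleting it together with its opposite undoes an insertion.\<close>

lemma standard_perm_SucE:
  assumes "standard_perm (Suc n) q"
  obtains p a where "standard_perm n p" "1 \<le> a" "a < 2 * Suc n" "q = insert_arc (Suc n) a p"
proof -
  let ?N = "int (Suc n)"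
  have "- ?N \<in> set q" using set_standard_perm_iff[OF assms] by simp
  then obtain s t where q: "q = s @ (- ?N) # t" by (meson split_list)
  have neg: "filter (\<lambda>x. x < 0) q = map (\<lambda>i. - int i) [1..<Suc (Suc n)]"
    using assms by (simp add: standard_perm_def)
  have dist: "distinct q" using assms by (simp add: standard_perm_def)
  have "filter (\<lambda>x. x < 0) t = []"
  proof -
    have eq: "filter (\<lambda>x. x < 0) s @ (- ?N) # filter (\<lambda>x. x < 0) t
        = map (\<lambda>i. - int i) [1..<Suc n] @ (- ?N) # []"
      using neg by (simp add: q)
    moreover have "- ?N \<notin> set (filter (\<lambda>x. x < 0) s)" "- ?N \<notin> set (filter (\<lambda>x. x < 0) t)"
      using dist q by auto
    ultimately show ?thesis
      using append_Cons_eq_iff by metis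
  qed
  have "t = []"
  proof (rule ccontr)
    assume "t \<noteq> []"
    then obtain z t' where t: "t = t' @ [z]" by (metis rev_exhaust)
    have "z \<in> set q" by (simp add: q t)
    then have mz: "- z \<in> set q" "z \<noteq> 0" using set_standard_perm_iff[OF assms] by auto
    have "- z \<in> set (s @ (- ?N) # t')" using mz by (auto simp: q t)
    then have "z < 0"
      using standard_perm_neg_before[of "Suc n" "s @ (- ?N) # t'" z "[]"] assms by (simp add: q t)
    with \<open>filter (\<lambda>x. x < 0) t = []\<close> show False by (simp add: t)
  qed
  have "?N \<in> set q" using set_standard_perm_iff[OF assms] by simp
  then have "?N \<in> set s" by (auto simp: q \<open>t = []\<close>)
  then obtain u v where "s = u @ ?N # v" by (meson split_list)
  then have quv: "q = u @ ?N # v @ [- ?N]" by (simp add: q \<open>t = []\<close>)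
  then have uv: "standard_perm n (u @ v)"
    using assms standard_perm_split_iff by metis
  have "length u \<le> 2 * n" using length_standard_perm[OF uv] by simp
  then show thesis
    using that[of "u @ v" "Suc (length u)"] uv quv by (simp add: insert_arc_def)
qed

text \<open>The entry \<open>int (Suc n)\<close> does not occur in \<open>p\<close> or
  \<open>p'\<close> and so marks the place of insertion. The bounds on \<open>a\<close> give
  \<open>take (a - 1) p\<close> the exact length \<open>a - 1\<close>, from which \<open>a\<close>
  is recovered.\<close>

lemma insert_arc_inj:
  assumes "standard_perm n p" "standard_perm n p'"
    and "1 \<le> a" "a < 2 * Suc n" "1 \<le> a'" "a' < 2 * Suc n"
    and "insert_arc (Suc n) a p = insert_arc (Suc n) a' p'"
  shows "a = a' \<and> p = p'"
proof -
  let ?N = "int (Suc n)"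
  have "?N \<notin> set p" "?N \<notin> set p'"
    using set_standard_perm_iff assms(1,2) by fastforce+
  then have nin: "?N \<notin> set (take (a - 1) p)" "?N \<notin> set (drop (a - 1) p)"
    by (meson in_set_takeD in_set_dropD)+
  have "take (a - 1) p @ ?N # drop (a - 1) p = take (a' - 1) p' @ ?N # drop (a' - 1) p'"
    using assms(7) by (simp add: insert_arc_def del: of_nat_Suc)
  then have *: "take (a - 1) p = take (a' - 1) p'" "drop (a - 1) p = drop (a' - 1) p'"
    using append_Cons_eq_iff[OF nin] by auto
  then have "p = p'" by (metis append_take_drop_id)
  moreover have "length (take (a - 1) p) = a - 1" "length (take (a' - 1) p') = a' - 1"
    using assms length_standard_perm[OF assms(1)] length_standard_perm[OF assms(2)] by auto
  then have "a = a'" using *(1) assms by (metis One_nat_def Suc_diff_le diff_Suc_Suc diff_zero)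
  ultimately show ?thesis by simp
qed

section \<open>The first closed cut\<close>

text \<open>Inclusion suffices because negation is an involution. The cut at 0 is closed as well,
  hence the condition \<open>0 < m\<close> in \<open>first_cut\<close>.\<close>

definition closed_cut :: "int list \<Rightarrow> nat \<Rightarrow> bool" where
  "closed_cut p m \<longleftrightarrow> uminus ` set (take m p) \<subseteq> set (take m p)"

text \<open>This is the number c(w) of the introduction, as a function of the permutation. For
  \<open>n \<ge> 1\<close> the full length of a standard permutation is a closed cut, so the minimum
  exists.\<close>

definition first_cut :: "int list \<Rightarrow> nat" where
  "first_cut p = (LEAST m. 0 < m \<and> closed_cut p m)"

lemma closed_cut_iff_card:
  assumes "standard_perm n p"
  shows "closed_cut p m \<longleftrightarrow> \<not> (\<exists>j\<in>{1..int n}. card (set (take m p) \<inter> {- j, j}) = 1)"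
proof -
  let ?S = "set (take m p)"
  have card: "card (?S \<inter> {- j, j}) = 1 \<longleftrightarrow> (j \<in> ?S) \<noteq> (- j \<in> ?S)" if "j \<in> {1..int n}" for j
    using that by (cases "j \<in> ?S"; cases "- j \<in> ?S") (auto simp: Int_insert_right)
  have sub: "1 \<le> \<bar>x\<bar> \<and> \<bar>x\<bar> \<le> int n" if "x \<in> ?S" for x
    using that set_standard_perm_iff[OF assms] by (meson in_set_takeD)
  show ?thesis
  proof
    assume c: "closed_cut p m"
    have "j \<in> ?S \<longleftrightarrow> - j \<in> ?S" for j
      using c unfolding closed_cut_def by (metis image_subset_iff minus_minus)
    then show "\<not> (\<exists>j\<in>{1..int n}. card (?S \<inter> {- j, j}) = 1)" using card by auto
  next
    assume "\<not> (\<exists>j\<in>{1..int n}. card (?S \<inter> {- j, j}) = 1)"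
    then have iff: "j \<in> ?S \<longleftrightarrow> - j \<in> ?S" if "j \<in> {1..int n}" for j using card that by blast
    have "- x \<in> ?S" if "x \<in> ?S" for x
      using sub[OF that] iff[of x] iff[of "- x"] that by (cases "x > 0") auto
    then show "closed_cut p m" by (auto simp: closed_cut_def)
  qed
qed

lemma closed_cut_length:
  assumes "standard_perm n p"
  shows "closed_cut p (2 * n)"
proof -
  have "- x \<in> set p" if "x \<in> set p" for x
    using that unfolding set_standard_perm_iff[OF assms] by simp
  then show ?thesis
    using length_standard_perm[OF assms] by (auto simp: closed_cut_def)
qed

lemma first_cut_props:
  assumes "standard_perm n p" "n \<ge> 1"
  shows "0 < first_cut p" "closed_cut p (first_cut p)" "first_cut p \<le> 2 * n"
    and "\<And>m. 0 < m \<Longrightarrow> m < first_cut p \<Longrightarrow> \<not> closed_cut p m"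
proof -
  have ex: "0 < 2 * n \<and> closed_cut p (2 * n)" using closed_cut_length assms by simp
  from LeastI[of "\<lambda>m. 0 < m \<and> closed_cut p m", OF ex]
  show "0 < first_cut p" "closed_cut p (first_cut p)" unfolding first_cut_def by auto
  from Least_le[of "\<lambda>m. 0 < m \<and> closed_cut p m", OF ex]
  show "first_cut p \<le> 2 * n" unfolding first_cut_def .
  show "\<not> closed_cut p m" if "0 < m" "m < first_cut p" for m
    using not_less_Least[of m "\<lambda>m. 0 < m \<and> closed_cut p m"] that unfolding first_cut_def by auto
qed

lemma sign_connected_iff_first_cut:
  assumes "standard_perm n p" "n \<ge> 1"
  shows "sign_connected n p \<longleftrightarrow> first_cut p = 2 * n"
proof -
  have "sign_connected n p \<longleftrightarrow> (\<forall>m. 1 \<le> m \<and> m < 2 * n \<longrightarrow> \<not> closed_cut p m)"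
    unfolding sign_connected_def closed_cut_iff_card[OF assms(1)] by blast
  also have "\<dots> \<longleftrightarrow> first_cut p = 2 * n"
    using first_cut_props[OF assms]
    by (metis One_nat_def Suc_leI le_neq_implies_less less_eq_Suc_le)
  finally show ?thesis .
qed

text \<open>A set of nonzero integers closed under negation consists of opposite pairs, and by
  distinctness the prefix has \<open>m\<close> elements.\<close>

lemma even_closed_cut:
  assumes "standard_perm n p" "closed_cut p m" "m \<le> 2 * n"
  shows "even m"
proof -
  let ?S = "set (take m p)"
  let ?P = "{x \<in> ?S. x > 0}"
  have nz: "0 \<notin> ?S"
    using set_standard_perm_iff[OF assms(1), of 0] by (auto dest: in_set_takeD)
  have cl: "- x \<in> ?S" if "x \<in> ?S" for x using assms(2) that by (auto simp: closed_cut_def)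
  have S: "?S = ?P \<union> uminus ` ?P"
  proof
    show "?S \<subseteq> ?P \<union> uminus ` ?P"
    proof
      fix x assume x: "x \<in> ?S"
      then have "x \<noteq> 0" using nz by metis
      then show "x \<in> ?P \<union> uminus ` ?P"
        using x cl[OF x] by (cases "x > 0") (auto simp: image_iff intro!: exI[of _ "- x"])
    qed
  qed (use cl in auto)
  have "distinct p" using assms(1) by (simp add: standard_perm_def)
  then have "card ?S = m"
    using assms(3) length_standard_perm[OF assms(1)] by (simp add: distinct_card)
  moreover have "card (?P \<union> uminus ` ?P) = card ?P + card (uminus ` ?P)"
    by (rule card_Un_disjoint) auto
  moreover have "card (uminus ` ?P) = card ?P" by (simp add: card_image)
  ultimately have "m = 2 * card ?P" using S by simp
  then show ?thesis by (metis dvd_triv_left)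
qed

lemma even_first_cut:
  "standard_perm n p \<Longrightarrow> n \<ge> 1 \<Longrightarrow> even (first_cut p)"
  using even_closed_cut first_cut_props(2,3) by blast

text \<open>The arc of \<open>Suc n\<close> reaches from position \<open>a\<close> to the end, so it destroys exactly the closed
  cuts at or after \<open>a\<close>.\<close>

lemma closed_cut_insert_arc:
  assumes "standard_perm n p" "1 \<le> a" "a < 2 * Suc n" "m < 2 * Suc n"
  shows "closed_cut (insert_arc (Suc n) a p) m \<longleftrightarrow> m < a \<and> closed_cut p m"
proof (cases "m < a")
  case True
  then have "take m (insert_arc (Suc n) a p) = take m p"
    using assms length_standard_perm[OF assms(1)] by (simp add: insert_arc_def min_def)
  with True show ?thesis by (simp add: closed_cut_def)
next
  case False
  let ?N = "int (Suc n)"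
  have len: "length p = 2 * n" using length_standard_perm[OF assms(1)] .
  let ?q = "take (a - 1) p @ ?N # drop (a - 1) p"
  \<comment> \<open>Since \<open>m < 2 * Suc n\<close>, the prefix stops before the appended end of
    the new arc; only the beginning of the arc can lie in it.\<close>
  have "take m (insert_arc (Suc n) a p) = take m ?q"
  proof -
    have "take m (xs @ ys) = take m xs" if "m \<le> length xs" for xs ys :: "int list"
      using that by simp
    from this[of ?q "[- ?N]"] show ?thesis
      using assms(3,4) len by (simp add: insert_arc_def del: take_append take_Cons')
  qed
  moreover have "- ?N \<notin> set (take m ?q)"
  proof -
    have "- ?N \<notin> set p" using set_standard_perm_iff[OF assms(1), of "- ?N"] by simp
    then have "- ?N \<notin> set ?q" by (auto dest: in_set_takeD in_set_dropD)
    then show ?thesis by (meson in_set_takeD)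
  qed
  moreover have "?N \<in> set (take m ?q)"
  proof -
    have "m - length (take (a - 1) p) \<noteq> 0" using False assms by auto
    then obtain k where k: "m - length (take (a - 1) p) = Suc k" by (metis not0_implies_Suc)
    show ?thesis unfolding take_append k by simp
  qed
  ultimately show ?thesis using False by (auto simp: closed_cut_def)
qed

text \<open>If \<open>a\<close> is at most the first cut, that cut and all later ones are destroyed,
  and only the full length remains. Otherwise the first cut lies before the new arc and
  survives.\<close>

lemma first_cut_insert_arc:
  assumes "standard_perm n p" "n \<ge> 1" "1 \<le> a" "a < 2 * Suc n"
  shows "first_cut (insert_arc (Suc n) a p) = (if a \<le> first_cut p then 2 * Suc n else first_cut p)"
proof -
  let ?q = "insert_arc (Suc n) a p"
  note q = first_cut_props[OF standard_perm_insert_arc[OF assms(1), of a], simplified]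
  note p = first_cut_props[OF assms(1,2)]
  note cc = closed_cut_insert_arc[OF assms(1,3,4)]
  show ?thesis
  proof (cases "a \<le> first_cut p")
    case True
    have "first_cut ?q = 2 * Suc n"
    proof (rule ccontr)
      assume "first_cut ?q \<noteq> 2 * Suc n"
      then have "first_cut ?q < 2 * Suc n" using q(3) by simp
      then have "first_cut ?q < a" "closed_cut p (first_cut ?q)" using cc q(2) by auto
      then show False using p(4) q(1) True by auto
    qed
    with True show ?thesis by simp
  next
    case False
    then have "closed_cut ?q (first_cut p)" using cc p(2,3) assms by simp
    moreover have "\<not> closed_cut ?q m" if "0 < m" "m < first_cut p" for m
      using cc[of m] p(3,4) that by auto
    ultimately have "first_cut ?q = first_cut p"
      using p(1) q(1,2,4) by (metis linorder_neqE_nat)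
    with False show ?thesis by simp
  qed
qed

lemma sign_connected_insert_arc_iff:
  assumes "standard_perm n p" "n \<ge> 1" "1 \<le> a" "a < 2 * Suc n"
  shows "sign_connected (Suc n) (insert_arc (Suc n) a p) \<longleftrightarrow> a \<le> first_cut p"
proof -
  \<comment> \<open>A surviving cut must not be mistaken for the new full length; it is at most
    \<open>2 * n\<close>.\<close>
  have "first_cut p \<noteq> 2 * Suc n" using first_cut_props(3)[OF assms(1,2)] by simp
  moreover have "sign_connected (Suc n) (insert_arc (Suc n) a p) \<longleftrightarrow>
      first_cut (insert_arc (Suc n) a p) = 2 * Suc n"
    using sign_connected_iff_first_cut[OF standard_perm_insert_arc[OF assms(1)]] by simp
  ultimately show ?thesis unfolding first_cut_insert_arc[OF assms] by simp
qed

text \<open>The entry at a first closed cut is negative in both permutations, while the negative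
  entries are never exchanged; hence the new entry cannot separate the transposed pair.\<close>

lemma adjacent_transposition_insert_arc_first_cut:
  assumes "standard_perm n p" "standard_perm n p'" "n \<ge> 1"
    and "adjacent_transposition p p'" "first_cut p = first_cut p'"
  shows "adjacent_transposition (insert_arc N (first_cut p) p) (insert_arc N (first_cut p) p')"
proof -
  obtain u x y v where p: "p = u @ x # y # v" and p': "p' = u @ y # x # v"
    using assms(4) unfolding adjacent_transposition_iff by blast
  define k where "k = first_cut p - 1"
  have ins: "insert_arc N (first_cut p) q = take k q @ int N # drop k q @ [- int N]" for q
    by (simp add: insert_arc_def k_def)
  have cut: "first_cut p > 0" "closed_cut p (first_cut p)" "closed_cut p' (first_cut p)"
    using first_cut_props[OF assms(1,3)] first_cut_props[OF assms(2,3)] assms(5) by auto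
  \<comment> \<open>Exactly \<open>k\<close> old entries precede the new one, so the transposed pair
    lies entirely to its right, entirely to its left, or on both sides of it.\<close>
  consider "k \<le> length u" | "k \<ge> length u + 2" | "k = Suc (length u)" by linarith
  then show ?thesis
  proof cases
    case 1
    then have "insert_arc N (first_cut p) p = (take k u @ int N # drop k u) @ x # y # v @ [- int N]"
      "insert_arc N (first_cut p) p' = (take k u @ int N # drop k u) @ y # x # v @ [- int N]"
      unfolding ins by (simp_all add: p p')
    then show ?thesis unfolding adjacent_transposition_iff by blast
  next
    case 2
    then obtain d where d: "k = length u + 2 + d" by (metis le_Suc_ex)
    then have "insert_arc N (first_cut p) p = u @ x # y # take d v @ int N # drop d v @ [- int N]"
      "insert_arc N (first_cut p) p' = u @ y # x # take d v @ int N # drop d v @ [- int N]"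
      unfolding ins by (simp_all add: p p')
    then show ?thesis unfolding adjacent_transposition_iff by blast
  next
    case 3
    then have c: "first_cut p = Suc (Suc (length u))" using cut(1) by (simp add: k_def)
    have sets: "x \<noteq> 0" "y \<noteq> 0"
      using set_standard_perm_iff[OF assms(1), of x] set_standard_perm_iff[OF assms(1), of y]
      by (auto simp: p)
    \<comment> \<open>The common cut ends at \<open>y\<close> in \<open>p\<close> and at
      \<open>x\<close> in \<open>p'\<close>. The opposite of each lies in the respective prefix and,
      as the entries are nonzero, strictly earlier.\<close>
    have "- y \<in> set (u @ [x, y])" "- x \<in> set (u @ [y, x])"
      using cut(2,3) unfolding c by (auto simp: closed_cut_def p p')
    then have "- y \<in> set (u @ [x])" "- x \<in> set (u @ [y])" using sets by auto
    then have "y < 0" "x < 0"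
      using standard_perm_neg_before[of n "u @ [x]" y v] assms(1)
        standard_perm_neg_before[of n "u @ [y]" x v] assms(2) by (auto simp: p p')
    have "filter (\<lambda>x. x < 0) p = filter (\<lambda>x. x < 0) p'"
      using assms(1,2) by (simp add: standard_perm_def)
    moreover have "filter (\<lambda>x. x < 0) p = filter (\<lambda>x. x < 0) u @ x # y # filter (\<lambda>x. x < 0) v"
      "filter (\<lambda>x. x < 0) p' = filter (\<lambda>x. x < 0) u @ y # x # filter (\<lambda>x. x < 0) v"
      using \<open>y < 0\<close> \<open>x < 0\<close> by (simp_all add: p p')
    ultimately have "x = y" by (metis list.inject same_append_eq)
    with assms(1) show ?thesis by (simp add: standard_perm_def p)
  qed
qed

section \<open>Lists with alternating conditions on neighbours\<close>

text \<open>The flag flips from pair to pair so that \<open>R\<close> can demand more of every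
  second pair. It follows the parity of positions, which decides the direction of the
  blocks.\<close>

fun alternately :: "(bool \<Rightarrow> 'a \<Rightarrow> 'a \<Rightarrow> bool) \<Rightarrow> bool \<Rightarrow> 'a list \<Rightarrow> bool" where
  "alternately R b (x # y # xs) \<longleftrightarrow> R b x y \<and> alternately R (\<not> b) (y # xs)"
| "alternately R b _ \<longleftrightarrow> True"

lemma all_nat_Suc: "(\<forall>i. P i) \<longleftrightarrow> P 0 \<and> (\<forall>i. P (Suc i))"
  by (metis not0_implies_Suc)

lemma alternately_iff_nth:
  "alternately R b xs \<longleftrightarrow> (\<forall>i. Suc i < length xs \<longrightarrow> R (b \<longleftrightarrow> even i) (xs ! i) (xs ! Suc i))"
proof (induction R b xs rule: alternately.induct)
  case (1 R b x y xs)
  have "(\<forall>i. Suc i < length (x # y # xs) \<longrightarrow> R (b \<longleftrightarrow> even i) ((x # y # xs) ! i) ((x # y # xs) ! Suc i))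
    \<longleftrightarrow> R b x y \<and> (\<forall>i. Suc i < length (y # xs) \<longrightarrow>
          R (b \<longleftrightarrow> even (Suc i)) ((y # xs) ! i) ((y # xs) ! Suc i))"
    by (subst all_nat_Suc) simp
  moreover have "(b \<longleftrightarrow> even (Suc i)) = (\<not> b \<longleftrightarrow> even i)" for i by auto
  ultimately show ?case using 1 by simp
qed auto

text \<open>Counted from 0, the junction is pair number \<open>length xs - 1\<close>, and its flag
  has been flipped that many times; \<open>ys\<close> starts one flip later.\<close>

lemma alternately_append:
  "alternately R b (xs @ ys) \<longleftrightarrow> alternately R b xs \<and> alternately R (b \<longleftrightarrow> even (length xs)) ys \<and>
     (xs \<noteq> [] \<longrightarrow> ys \<noteq> [] \<longrightarrow> R (b \<longleftrightarrow> odd (length xs)) (last xs) (hd ys))"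
proof (induction R b xs rule: alternately.induct)
  case (1 R b x y xs)
  have "(\<not> b \<longleftrightarrow> even (length (y # xs))) = (b \<longleftrightarrow> even (length (x # y # xs)))"
    "(\<not> b \<longleftrightarrow> odd (length (y # xs))) = (b \<longleftrightarrow> odd (length (x # y # xs)))" by auto
  with 1 show ?case by simp
next
  case ("2_2" R b x)
  then show ?case by (cases ys) auto
qed auto

text \<open>Entries with no selected entry between them become neighbours in the filtered list. This
  carries the result on the sublist back to positions in the whole list.\<close>

lemma successively_filter_nth:
  assumes "successively R (filter P xs)" "i < j" "j < length xs" "P (xs ! i)" "P (xs ! j)"
    and "\<And>k. i < k \<Longrightarrow> k < j \<Longrightarrow> \<not> P (xs ! k)"
  shows "R (xs ! i) (xs ! j)"
proof -
  define t where "t = drop (Suc i) xs"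
  have xs: "xs = take i xs @ xs ! i # t"
    using assms(2,3) by (metis id_take_nth_drop order.strict_trans t_def)
  have tl: "j - Suc i < length t" "t ! (j - Suc i) = xs ! j"
    using assms(2,3) by (auto simp: t_def)
  then have t: "t = take (j - Suc i) t @ xs ! j # drop (Suc (j - Suc i)) t"
    by (metis id_take_nth_drop)
  have "filter P (take (j - Suc i) t) = []"
    using assms(2,3,6) by (auto simp: filter_empty_conv in_set_conv_nth t_def)
  then have "filter P t = xs ! j # filter P (drop (Suc (j - Suc i)) t)"
    by (subst t) (simp add: assms(5))
  then have "filter P xs = filter P (take i xs) @ xs ! i # xs ! j # filter P (drop (Suc (j - Suc i)) t)"
    by (subst xs) (simp add: assms(4))
  with assms(1) show ?thesis by (simp add: successively_append_iff)
qed

section \<open>The Gray code\<close>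

lemma word_perm_snoc:
  "w \<noteq> [] \<Longrightarrow> word_perm (w @ [x]) = insert_arc (Suc (length w)) x (word_perm w)"
  by (cases w rule: rev_cases) (auto simp: word_perm_def)

text \<open>This replaces the index \<open>m\<close> of \<open>gray_block\<close> by a flag for its
  parity, which permits induction on the list of words.\<close>

fun alt_ext :: "nat \<Rightarrow> bool \<Rightarrow> nat list list \<Rightarrow> nat list list" where
  "alt_ext n b [] = []"
| "alt_ext n b (w # ws) =
     map (\<lambda>x. w @ [x]) (if b then [1..<2 * n] else rev [1..<2 * n]) @ alt_ext n (\<not> b) ws"

text \<open>The start index \<open>k\<close> is arbitrary because passing to the tail raises it by
  one; the recursion of \<open>gray_words\<close> is the case \<open>k = 1\<close>.\<close>

lemma concat_gray_block_eq_alt_ext: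
  "concat (map (\<lambda>m. gray_block n m (W ! (m - k))) [k..<k + length W]) = alt_ext n (odd k) W"
proof (induction W arbitrary: k)
  case (Cons w W)
  have "map (\<lambda>m. gray_block n m ((w # W) ! (m - k))) [Suc k..<Suc k + length W]
      = map (\<lambda>m. gray_block n m (W ! (m - Suc k))) [Suc k..<Suc k + length W]"
    by (rule map_cong) (auto simp: nth_Cons')
  then have "concat (map (\<lambda>m. gray_block n m ((w # W) ! (m - k))) [Suc k..<Suc k + length W])
      = alt_ext n (even k) W"
    using Cons[of "Suc k"] by (simp only:) simp
  then show ?case
    by (simp add: upt_conv_Cons gray_block_def[of n k] del: upt_Suc)
qed simp

lemma gray_words_Suc:
  "n \<ge> 1 \<Longrightarrow> gray_words (Suc n) = alt_ext (Suc n) True (gray_words n)"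
  using concat_gray_block_eq_alt_ext[of "Suc n" "gray_words n" 1] by (cases n) (simp_all add: Let_def)

text \<open>The flag is true when \<open>w\<close> has odd index. Then the blocks of
  \<open>w\<close> and \<open>w'\<close> in the next list meet at their largest letters, and equal
  cuts are required.\<close>

definition gray_step :: "bool \<Rightarrow> nat list \<Rightarrow> nat list \<Rightarrow> bool" where
  "gray_step b w w' \<longleftrightarrow> adjacent_transposition (word_perm w) (word_perm w') \<and>
     (b \<longrightarrow> first_cut (word_perm w) = first_cut (word_perm w'))"

definition standard_word :: "nat \<Rightarrow> nat list \<Rightarrow> bool" where
  "standard_word n w \<longleftrightarrow> length w = n \<and> standard_perm n (word_perm w)"

lemma word_perm_standard_word_snoc:
  "standard_word n w \<Longrightarrow> n \<ge> 1 \<Longrightarrow> word_perm (w @ [x]) = insert_arc (Suc n) x (word_perm w)"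
  using word_perm_snoc[of w x] by (cases w) (auto simp: standard_word_def)

lemma standard_word_snoc:
  "standard_word n w \<Longrightarrow> n \<ge> 1 \<Longrightarrow> standard_word (Suc n) (w @ [x])"
  using standard_perm_insert_arc[of n "word_perm w" x] word_perm_standard_word_snoc[of n w x]
  by (auto simp: standard_word_def)

lemma set_alt_ext:
  "set (alt_ext n b W) = {w @ [x] | w x. w \<in> set W \<and> x \<in> {1..<2 * n}}"
  by (induction W arbitrary: b) auto

text \<open>The threshold \<open>first_cut\<close> is even, so it never separates an odd
  \<open>x\<close> from \<open>Suc x\<close>; by \<open>first_cut_insert_arc\<close> both extensions
  then have the same first cut.\<close>

lemma gray_step_block:
  assumes "standard_word n w" "n \<ge> 1" "1 \<le> x" "x \<le> 2 * n"
  shows "gray_step (odd x) (w @ [x]) (w @ [Suc x])" "gray_step (odd x) (w @ [Suc x]) (w @ [x])"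
proof -
  let ?p = "word_perm w"
  have p: "standard_perm n ?p" using assms(1) by (simp add: standard_word_def)
  have adj: "adjacent_transposition (insert_arc (Suc n) x ?p) (insert_arc (Suc n) (Suc x) ?p)"
    using adjacent_transposition_insert_arc_Suc assms length_standard_perm[OF p] by simp
  have "x \<le> first_cut ?p \<longleftrightarrow> Suc x \<le> first_cut ?p" if "odd x"
    using that even_first_cut[OF p assms(2)] by (metis Suc_leI Suc_leD le_neq_implies_less)
  then have "first_cut (insert_arc (Suc n) x ?p) = first_cut (insert_arc (Suc n) (Suc x) ?p)"
    if "odd x"
    using that first_cut_insert_arc[OF p assms(2)] assms by simp
  with adj adjacent_transposition_sym[OF adj]
  show "gray_step (odd x) (w @ [x]) (w @ [Suc x])" "gray_step (odd x) (w @ [Suc x]) (w @ [x])"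
    by (auto simp: gray_step_def word_perm_standard_word_snoc[OF assms(1,2)])
qed

text \<open>The letter 1 puts the new entry in front, and \<open>Suc (2 * n)\<close> puts it just
  before its opposite at the end, so the old transposition stays intact. In the second case the
  letter exceeds both first cuts, which are therefore inherited.\<close>

lemma gray_step_between_blocks:
  assumes "standard_word n w" "standard_word n w'" "n \<ge> 1" "gray_step b w w'"
  shows "gray_step b (w @ [if b then Suc (2 * n) else 1]) (w' @ [if b then Suc (2 * n) else 1])"
proof -
  have p: "standard_perm n (word_perm w)" "standard_perm n (word_perm w')"
    using assms by (simp_all add: standard_word_def)
  have adj: "adjacent_transposition (word_perm w) (word_perm w')"
    using assms by (simp add: gray_step_def)
  have "adjacent_transposition (insert_arc (Suc n) 1 (word_perm w)) (insert_arc (Suc n) 1 (word_perm w'))"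
    using adjacent_transposition_append[OF adj, of "[int (Suc n)]" "[- int (Suc n)]"]
    by (simp add: insert_arc_def)
  moreover have "adjacent_transposition (insert_arc (Suc n) (Suc (2 * n)) (word_perm w))
      (insert_arc (Suc n) (Suc (2 * n)) (word_perm w'))"
    using adjacent_transposition_append[OF adj, of "[]" "[int (Suc n), - int (Suc n)]"]
      length_standard_perm[OF p(1)] length_standard_perm[OF p(2)]
    by (simp add: insert_arc_def)
  moreover have "first_cut (insert_arc (Suc n) (Suc (2 * n)) (word_perm w))
      = first_cut (insert_arc (Suc n) (Suc (2 * n)) (word_perm w'))" if b
    using that first_cut_insert_arc[OF p(1) assms(3)] first_cut_insert_arc[OF p(2) assms(3)] assms(4)
    by (simp add: gray_step_def)
  ultimately show ?thesis
    using word_perm_standard_word_snoc[OF assms(1,3)] word_perm_standard_word_snoc[OF assms(2,3)]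
    by (auto simp: gray_step_def)
qed

text \<open>In both directions the flag is true exactly between an odd letter \<open>x\<close> and
  \<open>Suc x\<close>: ascending blocks start at 1 with flag true, descending ones at
  \<open>2 * n + 1\<close> with flag false.\<close>

lemma alternately_gray_step_block:
  assumes "standard_word n w" "n \<ge> 1"
  shows "alternately gray_step b
    (map (\<lambda>x. w @ [x]) (if b then [1..<2 * Suc n] else rev [1..<2 * Suc n]))"
proof (cases b)
  case True
  have "gray_step (even i) (w @ [Suc i]) (w @ [Suc (Suc i)])" if "Suc i < 2 * n + 1" for i
    using gray_step_block(1)[OF assms, of "Suc i"] that by simp
  with True show ?thesis
    unfolding alternately_iff_nth by (auto simp del: upt_Suc)
next
  case False
  have "gray_step (odd i) (w @ [Suc (2 * n - i)]) (w @ [Suc (2 * n - Suc i)])" if "i < 2 * n" for i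
  proof -
    have "Suc (2 * n - Suc i) = 2 * n - i" "odd (2 * n - i) = odd i"
      using that by auto
    then show ?thesis using gray_step_block(2)[OF assms, of "2 * n - i"] that by simp
  qed
  with False show ?thesis
    unfolding alternately_iff_nth by (auto simp: rev_nth simp del: upt_Suc)
qed

text \<open>Each block has odd length \<open>2 * n + 1\<close>. So the junction after the block of
  \<open>w\<close> carries the same flag as the pair formed by \<open>w\<close> and its successor in
  \<open>W\<close>, and the next block starts with the opposite flag.\<close>

lemma alternately_gray_step_alt_ext:
  assumes "n \<ge> 1" "\<forall>w\<in>set W. standard_word n w" "alternately gray_step b W"
  shows "alternately gray_step b (alt_ext (Suc n) b W)"
  using assms(2,3)
proof (induction W arbitrary: b)
  case (Cons w W)
  let ?B = "map (\<lambda>x. w @ [x]) (if b then [1..<2 * Suc n] else rev [1..<2 * Suc n])"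
  have W: "alternately gray_step (\<not> b) W" using Cons.prems(2) by (cases W) auto
  have IH: "alternately gray_step (\<not> b) (alt_ext (Suc n) (\<not> b) W)"
    using Cons.IH[OF _ W] Cons.prems(1) by simp
  have len: "odd (length ?B)" by auto
  have "gray_step b (last ?B) (hd (alt_ext (Suc n) (\<not> b) W))" if ne: "alt_ext (Suc n) (\<not> b) W \<noteq> []"
  proof -
    obtain w' W' where W': "W = w' # W'" using ne by (cases W) auto
    have "last ?B = w @ [if b then Suc (2 * n) else 1]"
      by (auto simp: last_map last_rev hd_map)
    moreover have "hd (alt_ext (Suc n) (\<not> b) W) = w' @ [if b then Suc (2 * n) else 1]"
      by (auto simp: W' hd_append hd_map hd_rev)
    moreover have "gray_step b w w'" using Cons.prems(2) by (simp add: W')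
    ultimately show ?thesis
      using gray_step_between_blocks[OF _ _ assms(1), of w w' b] Cons.prems(1) by (simp add: W')
  qed
  then show ?case
    using alternately_gray_step_block[OF _ assms(1), of w b] Cons.prems(1) IH len
    by (simp only: alt_ext.simps alternately_append) simp
qed simp

section \<open>The sublist of sign-connected permutations\<close>

lemma filter_sign_connected_block:
  assumes "standard_word n w" "n \<ge> 1"
  shows "filter (sign_connected (Suc n)) (map word_perm (map (\<lambda>x. w @ [x])
      (if b then [1..<2 * Suc n] else rev [1..<2 * Suc n])))
    = map (\<lambda>a. insert_arc (Suc n) a (word_perm w))
      (if b then [1..<Suc (first_cut (word_perm w))] else rev [1..<Suc (first_cut (word_perm w))])"
proof -
  let ?p = "word_perm w" and ?c = "first_cut (word_perm w)"
  have p: "standard_perm n ?p" using assms(1) by (simp add: standard_word_def)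
  have c: "?c \<le> 2 * n" using first_cut_props(3)[OF p assms(2)] .
  have "[1..<2 * Suc n] = [1..<Suc ?c] @ [Suc ?c..<2 * Suc n]"
    using c upt_add_eq_append[of 1 "Suc ?c" "2 * Suc n - Suc ?c"] by (simp del: upt_Suc)
  moreover have "filter (\<lambda>a. a \<le> ?c) [1..<Suc ?c] = [1..<Suc ?c]"
    by (rule filter_True) auto
  moreover have "filter (\<lambda>a. a \<le> ?c) [Suc ?c..<2 * Suc n] = []"
    by (rule filter_False) auto
  ultimately have f: "filter (\<lambda>a. a \<le> ?c) [1..<2 * Suc n] = [1..<Suc ?c]"
    by (simp del: upt_Suc)
  have "filter (\<lambda>a. sign_connected (Suc n) (insert_arc (Suc n) a ?p)) [1..<2 * Suc n] =
      filter (\<lambda>a. a \<le> ?c) [1..<2 * Suc n]"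
    using sign_connected_insert_arc_iff[OF p assms(2)] by (intro filter_cong) auto
  then have g: "filter (\<lambda>a. sign_connected (Suc n) (insert_arc (Suc n) a ?p)) [1..<2 * Suc n] = [1..<Suc ?c]"
    using f by simp
  show ?thesis
    using g by (simp add: filter_map comp_def word_perm_standard_word_snoc[OF assms] rev_filter[symmetric]
        del: upt_Suc mult_Suc_right)
qed

text \<open>Inside a filtered block the letter changes in unit steps. Blocks meeting at the letter 1
  have the new entry in front on both sides; blocks meeting at their first cuts have equal cuts by
  the flagged part of \<open>gray_step\<close>, so
  \<open>adjacent_transposition_insert_arc_first_cut\<close> applies.\<close>

lemma successively_filter_alt_ext:
  assumes "n \<ge> 1" "\<forall>w\<in>set W. standard_word n w" "alternately gray_step b W"
  shows "successively adjacent_transposition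
    (filter (sign_connected (Suc n)) (map word_perm (alt_ext (Suc n) b W)))"
  using assms(2,3)
proof (induction W arbitrary: b)
  case (Cons w W)
  let ?F = "\<lambda>b W. filter (sign_connected (Suc n)) (map word_perm (alt_ext (Suc n) b W))"
  define B where "B = (\<lambda>b w. map (\<lambda>a. insert_arc (Suc n) a (word_perm w))
      (if b then [1..<Suc (first_cut (word_perm w))] else rev [1..<Suc (first_cut (word_perm w))]))"
  have F: "?F b (w # W) = B b w @ ?F (\<not> b) W" if "standard_word n w" for b w W
    unfolding B_def filter_sign_connected_block[OF that assms(1), symmetric] by simp
  have w: "standard_word n w" "standard_perm n (word_perm w)"
    using Cons.prems(1) by (simp_all add: standard_word_def)
  \<comment> \<open>No block is filtered to the empty list, so consecutive filtered blocks come from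
    consecutive words.\<close>
  have cpos: "first_cut (word_perm w) > 0" if "standard_word n w" for w
    using that first_cut_props(1) assms(1) by (auto simp: standard_word_def)
  have W: "alternately gray_step (\<not> b) W" using Cons.prems(2) by (cases W) auto
  have IH: "successively adjacent_transposition (?F (\<not> b) W)"
    using Cons.IH[OF _ W] Cons.prems(1) by simp
  have step: "adjacent_transposition (insert_arc (Suc n) a (word_perm w)) (insert_arc (Suc n) (Suc a) (word_perm w))"
    if "1 \<le> a" "a < first_cut (word_perm w)" for a
    using adjacent_transposition_insert_arc_Suc that first_cut_props(3)[OF w(2) assms(1)]
      length_standard_perm[OF w(2)] by simp
  have B: "successively adjacent_transposition (B b w)"
  proof -
    let ?f = "\<lambda>a. insert_arc (Suc n) a (word_perm w)"
    have "successively (\<lambda>a a'. adjacent_transposition (?f a) (?f a')) [1..<Suc (first_cut (word_perm w))]"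
      "successively (\<lambda>a a'. adjacent_transposition (?f a') (?f a)) [1..<Suc (first_cut (word_perm w))]"
      using step adjacent_transposition_sym[OF step]
      by (auto simp: successively_conv_nth simp del: upt_Suc)
    then show ?thesis
      by (simp add: B_def successively_map del: upt_Suc)
  qed
  have junction: "adjacent_transposition (last (B b w)) (hd (?F (\<not> b) W))" if ne: "?F (\<not> b) W \<noteq> []"
  proof -
    obtain w' W' where W': "W = w' # W'" using ne by (cases W) auto
    have w': "standard_word n w'" "standard_perm n (word_perm w')"
      using Cons.prems(1) by (simp_all add: standard_word_def W')
    have gs: "gray_step b w w'" using Cons.prems(2) by (simp add: W')
    have "last (B b w) = insert_arc (Suc n) (if b then first_cut (word_perm w) else 1) (word_perm w)"
      using cpos[OF w(1)] by (auto simp: B_def last_map last_rev hd_map simp del: upt_Suc)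
    moreover have "hd (?F (\<not> b) W) =
        insert_arc (Suc n) (if b then first_cut (word_perm w') else 1) (word_perm w')"
      using cpos[OF w'(1)] unfolding W' F[OF w'(1)]
      by (auto simp: B_def hd_append hd_map hd_rev simp del: upt_Suc)
    moreover have "adjacent_transposition (insert_arc (Suc n) 1 (word_perm w)) (insert_arc (Suc n) 1 (word_perm w'))"
      using adjacent_transposition_append[of "word_perm w" "word_perm w'" "[int (Suc n)]" "[- int (Suc n)]"] gs
      by (simp add: insert_arc_def gray_step_def)
    ultimately show ?thesis
      using adjacent_transposition_insert_arc_first_cut[OF w(2) w'(2) assms(1)] gs
      by (auto simp: gray_step_def)
  qed
  show ?case
    unfolding F[OF w(1)] successively_append_iff using B IH junction by blast
qed simp

section \<open>Each standard permutation is listed exactly once\<close>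

lemma word_perm_image_alt_ext:
  assumes "n \<ge> 1" "\<forall>w\<in>set W. standard_word n w"
  shows "word_perm ` set (alt_ext (Suc n) b W) =
    {insert_arc (Suc n) a p | a p. a \<in> {1..<2 * Suc n} \<and> p \<in> word_perm ` set W}"
proof -
  have "word_perm ` set (alt_ext (Suc n) b W) =
      {word_perm (w @ [x]) | w x. w \<in> set W \<and> x \<in> {1..<2 * Suc n}}"
    unfolding set_alt_ext by blast
  also have "\<dots> = {insert_arc (Suc n) x (word_perm w) | w x. w \<in> set W \<and> x \<in> {1..<2 * Suc n}}"
    using word_perm_standard_word_snoc[OF bspec[OF assms(2)] assms(1)] by (metis (no_types, lifting))
  also have "\<dots> = {insert_arc (Suc n) a p | a p. a \<in> {1..<2 * Suc n} \<and> p \<in> word_perm ` set W}"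
    by blast
  finally show ?thesis .
qed

lemma distinct_word_perm_alt_ext:
  assumes "n \<ge> 1" "\<forall>w\<in>set W. standard_word n w" "distinct (map word_perm W)"
  shows "distinct (map word_perm (alt_ext (Suc n) b W))"
  using assms(2,3)
proof (induction W arbitrary: b)
  case (Cons w W)
  let ?B = "map word_perm (map (\<lambda>x. w @ [x]) (if b then [1..<2 * Suc n] else rev [1..<2 * Suc n]))"
  have w: "standard_word n w" and W: "\<forall>w\<in>set W. standard_word n w" using Cons.prems by auto
  have sp: "standard_perm n (word_perm v)" if "v \<in> set (w # W)" for v
    using bspec[OF Cons.prems(1) that] by (simp add: standard_word_def)
  have B: "?B = map (\<lambda>a. insert_arc (Suc n) a (word_perm w))
      (if b then [1..<2 * Suc n] else rev [1..<2 * Suc n])"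
    using word_perm_standard_word_snoc[OF w assms(1)] by simp
  have "inj_on (\<lambda>a. insert_arc (Suc n) a (word_perm w)) {1..<2 * Suc n}"
    using insert_arc_inj[OF sp[of w] sp[of w]] by (auto intro!: inj_onI)
  then have "distinct ?B" unfolding B by (auto simp: distinct_map simp del: upt_Suc)
  moreover have "distinct (map word_perm (alt_ext (Suc n) (\<not> b) W))"
    using Cons.IH[OF W] Cons.prems(2) by simp
  moreover have "set ?B \<inter> set (map word_perm (alt_ext (Suc n) (\<not> b) W)) = {}"
  proof (rule ccontr)
    assume "set ?B \<inter> set (map word_perm (alt_ext (Suc n) (\<not> b) W)) \<noteq> {}"
    then obtain q where q: "q \<in> set ?B" "q \<in> set (map word_perm (alt_ext (Suc n) (\<not> b) W))"
      by blast
    from q(1) obtain a where a: "q = insert_arc (Suc n) a (word_perm w)" "1 \<le> a" "a < 2 * Suc n"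
      unfolding B by (auto split: if_splits simp del: upt_Suc)
    from q(2) obtain a' v where v: "q = insert_arc (Suc n) a' (word_perm v)" "1 \<le> a'" "a' < 2 * Suc n"
      "v \<in> set W"
      unfolding set_map word_perm_image_alt_ext[OF assms(1) W] by auto
    have "word_perm w = word_perm v"
      using insert_arc_inj[OF sp[of w] sp[of v]] a v by auto
    then show False using Cons.prems(2) v(4) by auto
  qed
  ultimately show ?case by (simp only: alt_ext.simps map_append distinct_append)
qed simp

text \<open>In the induction, the claim on the connected sublist for \<open>Suc n\<close> comes from
  the alternating condition on the full list for \<open>n\<close>, not from the connected sublist
  for \<open>n\<close>.\<close>

lemma gray_words_invariants:
  assumes "n \<ge> 1"
  shows "\<forall>w \<in> set (gray_words n). standard_word n w"
    and "alternately gray_step True (gray_words n)"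
    and "distinct (map word_perm (gray_words n))"
    and "word_perm ` set (gray_words n) = {p. standard_perm n p}"
    and "successively adjacent_transposition (filter (sign_connected n) (map word_perm (gray_words n)))"
proof -
  have "(\<forall>w \<in> set (gray_words n). standard_word n w) \<and>
    alternately gray_step True (gray_words n) \<and>
    distinct (map word_perm (gray_words n)) \<and>
    word_perm ` set (gray_words n) = {p. standard_perm n p} \<and>
    successively adjacent_transposition (filter (sign_connected n) (map word_perm (gray_words n)))"
    using assms
  proof (induction n rule: dec_induct)
    case base
    \<comment> \<open>The case of length 1 is also an insertion, into the empty permutation, so
      \<open>standard_perm_SucE\<close> classifies its standard permutations although
      \<open>gray_words 0\<close> is only a default.\<close>
    have ia: "insert_arc (Suc 0) a [] = [1, - 1]" for a by (simp add: insert_arc_def)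
    have sp: "standard_perm (Suc 0) p \<longleftrightarrow> p = [1, - 1]" for p
      using standard_perm_insert_arc[of 0 "[]" 1] standard_perm_SucE[of 0 p]
      by (metis ia standard_perm_0_iff)
    then show ?case by (auto simp: standard_word_def word_perm_def)
  next
    case (step n)
    let ?G = "gray_words n"
    have std: "\<forall>w\<in>set ?G. standard_word n w" using step.IH by blast
    have G: "gray_words (Suc n) = alt_ext (Suc n) True ?G" using gray_words_Suc[OF step.hyps(1)] .
    have words: "standard_word (Suc n) w" if "w \<in> set (gray_words (Suc n))" for w
      using that standard_word_snoc[OF bspec[OF std] step.hyps(1)] unfolding G set_alt_ext by blast
    have image: "word_perm ` set (gray_words (Suc n)) = {q. standard_perm (Suc n) q}"
    proof -
      have "word_perm ` set (gray_words (Suc n)) =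
          {insert_arc (Suc n) a p | a p. a \<in> {1..<2 * Suc n} \<and> standard_perm n p}"
        unfolding G word_perm_image_alt_ext[OF step.hyps(1) std] using step.IH by simp
      also have "\<dots> = {q. standard_perm (Suc n) q}"
      proof (intro set_eqI iffI)
        fix q assume "q \<in> {q. standard_perm (Suc n) q}"
        then have "standard_perm (Suc n) q" by simp
        then obtain p a where "standard_perm n p" "1 \<le> a" "a < 2 * Suc n" "q = insert_arc (Suc n) a p"
          by (rule standard_perm_SucE)
        then show "q \<in> {insert_arc (Suc n) a p | a p. a \<in> {1..<2 * Suc n} \<and> standard_perm n p}"
          unfolding mem_Collect_eq atLeastLessThan_iff by blast
      qed (use standard_perm_insert_arc in blast)
      finally show ?thesis .
    qed
    show ?case
    proof (intro conjI ballI)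
      show "alternately gray_step True (gray_words (Suc n))"
        unfolding G using alternately_gray_step_alt_ext[OF step.hyps(1) std] step.IH by simp
      show "distinct (map word_perm (gray_words (Suc n)))"
        unfolding G using distinct_word_perm_alt_ext[OF step.hyps(1) std] step.IH by simp
      show "successively adjacent_transposition
          (filter (sign_connected (Suc n)) (map word_perm (gray_words (Suc n))))"
        unfolding G using successively_filter_alt_ext[OF step.hyps(1) std] step.IH by simp
    qed (fact words image)+
  qed
  then show "\<forall>w \<in> set (gray_words n). standard_word n w"
    and "alternately gray_step True (gray_words n)"
    and "distinct (map word_perm (gray_words n))"
    and "word_perm ` set (gray_words n) = {p. standard_perm n p}"
    and "successively adjacent_transposition (filter (sign_connected n) (map word_perm (gray_words n)))"
    by blast+
qed

theorem theorem6p1: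
  fixes n :: nat
  assumes "n \<ge> 1"
  shows "(\<forall>i j. i < length (gray_words n) \<and> j < length (gray_words n) \<and>
            gray_words n ! i \<noteq> gray_words n ! j \<and>
            arc_connected (gray_words n ! i) \<and> arc_connected (gray_words n ! j) \<and>
            (\<forall>k. (i < k \<and> k < j) \<or> (j < k \<and> k < i) \<longrightarrow> \<not> arc_connected (gray_words n ! k)) \<longrightarrow>
            adjacent_transposition (word_perm (gray_words n ! i)) (word_perm (gray_words n ! j)))
       \<and> adjacent_transposition_gray_code
            {p. standard_perm n p \<and> sign_connected n p}
            (filter (sign_connected n) (map word_perm (gray_words n)))"
proof (intro conjI allI impI)
  let ?G = "gray_words n"
  note inv = gray_words_invariants[OF assms]
  have conn: "arc_connected (?G ! k) \<longleftrightarrow> sign_connected n (map word_perm ?G ! k)" if "k < length ?G" for k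
    using inv(1) that by (auto simp: arc_connected_def standard_word_def)
  \<comment> \<open>Only one order of the positions is treated here; the other follows by symmetry
    of adjacent transpositions.\<close>
  have ordered: "adjacent_transposition (word_perm (?G ! i)) (word_perm (?G ! j))"
    if "i < j" "j < length ?G" "arc_connected (?G ! i)" "arc_connected (?G ! j)"
      "\<And>k. i < k \<Longrightarrow> k < j \<Longrightarrow> \<not> arc_connected (?G ! k)" for i j
    using successively_filter_nth[OF inv(5), of i j] that conn by simp
  fix i j
  assume a: "i < length ?G \<and> j < length ?G \<and> ?G ! i \<noteq> ?G ! j \<and>
      arc_connected (?G ! i) \<and> arc_connected (?G ! j) \<and>
      (\<forall>k. (i < k \<and> k < j) \<or> (j < k \<and> k < i) \<longrightarrow> \<not> arc_connected (?G ! k))"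
  then consider "i < j" | "j < i" by (metis linorder_neqE_nat)
  then show "adjacent_transposition (word_perm (?G ! i)) (word_perm (?G ! j))"
  proof cases
    case 1
    then show ?thesis using a by (intro ordered) auto
  next
    case 2
    then show ?thesis using a by (intro adjacent_transposition_sym[OF ordered]) auto
  qed
next
  note inv = gray_words_invariants[OF assms]
  show "adjacent_transposition_gray_code {p. standard_perm n p \<and> sign_connected n p}
      (filter (sign_connected n) (map word_perm (gray_words n)))"
    unfolding adjacent_transposition_gray_code_def
    using inv(3-5) by (auto simp: successively_conv_nth)
qed

end
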